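(* There exist a Hilbert space $K$, a closed subspace $M$ of $K$ and an operator $T\in\mathbb{B}(K)$ such that $T$ is $(M,M)$-weakly complementable, whereas $T$ is not $(M,M)$-complementable.
   Context: $\mathbb{B}(H_1,K_1)$ denotes the bounded linear operators between Hilbert spaces $H_1,K_1$ and $\mathbb{B}(K)=\mathbb{B}(K,K)$. $\mathcal{R}(\cdot)$ is the range, the bar denotes norm closure, $|R|=(R^*R)^{1/2}$, and $P_M$ is the orthogonal projection of $K$ onto $M$. $T\in\mathbb{B}(K)$ is $(M,M)$-complementable if there exist $M_r,M_l\in\mathbb{B}(K)$ such that $(I-P_M)M_r=M_r$, $M_l(I-P_M)=M_l$, $(I-P_M)TM_r=(I-P_M)T$ and $M_lT(I-P_M)=T(I-P_M)$. Reduced solution: for $A\in\mathbb{B}(H_1,K_1)$, $C\in\mathbb{B}(E_1,K_1)$, an operator $D\in\mathbb{B}(E_1,H_1)$ is the reduced solution of $AX=C$, $X\in\mathbb{B}(E_1,H_1)$, if $AD=C$ and $\mathcal{R}(D)\subseteq\overline{\mathcal{R}(A^* )}$ (unique if it exists). For every $R\in\mathbb{B}(H_1,K_1)$ the system $|R^*|^{1/2}X=R$ has a reduced solution $V_R\in\mathbb{B}(H_1,K_1)$. With $P_{M^\perp}=I-P_M$, put $T_{12}=P_MTP_{M^\perp}|_{M^\perp}\in\mathbb{B}(M^\perp,M)$, $T_{21}=P_{M^\perp}TP_M|_M\in\mathbb{B}(M,M^\perp)$, $T_{22}=P_{M^\perp}TP_{M^\perp}|_{M^\perp}\in\mathbb{B}(M^\perp)$.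 $T$ is $(M,M)$-weakly complementable if all four systems $V_{T_{22}}Y_1=T_{21}$, $|T_{22}|^{1/2}Y_2=T_{12}^*$, $|T_{22}^*|^{1/2}Z_1=T_{21}$, $V_{T_{22}}^*Z_2=T_{12}^*$ (with unknowns $Y_1,Y_2,Z_1,Z_2\in\mathbb{B}(M,M^\perp)$) have reduced solutions. *)

theory Defs
  imports
    "HOL-Analysis.Abstract_Metric_Spaces"
    "HOL-Library.Nonpos_Ints"
    "HOL-Algebra.Module"
    "HOL-Algebra.Algebraic_Closure_Type"
begin

section \<open>Complex Hilbert spaces\<close>

text \<open>
  Hilbert spaces are carrier-based, so that a closed subspace \<open>M\<close> of \<open>K\<close> is again a Hilbert space,
  namely \<open>K\<lparr>carrier := M\<rparr>\<close>. Of the record fields inherited from \<^type>\<open>module\<close>, the ring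
  multiplication and unit carry no meaning. Scalars are on the left, in the ring
  \<open>ring_of_type_algebra\<close> of all complex numbers; the inner product is linear in its first argument.
\<close>

record 'a hspace = "(complex, 'a) module" +
  cinner :: "'a \<Rightarrow> 'a \<Rightarrow> complex"

definition hnorm :: "'a hspace \<Rightarrow> 'a \<Rightarrow> real"
  where "hnorm H x = sqrt (Re (cinner H x x))"

text \<open>
  The distance is set to \<open>0\<close> off the carrier only because \<^locale>\<open>Metric_space\<close> demands
  nonnegativity and symmetry on the whole type.
\<close>

definition hdist :: "'a hspace \<Rightarrow> 'a \<Rightarrow> 'a \<Rightarrow> real"
  where "hdist H x y =
    (if x \<in> carrier H \<and> y \<in> carrier H then hnorm H (x \<ominus>\<^bsub>H\<^esub> y) else 0)"

definition htopology :: "'a hspace \<Rightarrow> 'a topology"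
  where "htopology H = Metric_space.mtopology (carrier H) (hdist H)"

locale hilbert_space = Module.module "ring_of_type_algebra :: complex ring" H
  for H :: "'a hspace" (structure) +
  assumes cinner_add_left:
      "\<lbrakk>x \<in> carrier H; y \<in> carrier H; z \<in> carrier H\<rbrakk>
        \<Longrightarrow> cinner H (x \<oplus>\<^bsub>H\<^esub> y) z = cinner H x z + cinner H y z"
    and cinner_smult_left:
      "\<lbrakk>x \<in> carrier H; y \<in> carrier H\<rbrakk> \<Longrightarrow> cinner H (c \<odot>\<^bsub>H\<^esub> x) y = c * cinner H x y"
    and cinner_commute:
      "\<lbrakk>x \<in> carrier H; y \<in> carrier H\<rbrakk> \<Longrightarrow> cinner H x y = cnj (cinner H y x)"
    and cinner_nonneg: "x \<in> carrier H \<Longrightarrow> cinner H x x \<in> \<real>\<^sub>\<ge>\<^sub>0"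
    and cinner_definite: "\<lbrakk>x \<in> carrier H; cinner H x x = 0\<rbrakk> \<Longrightarrow> x = \<zero>\<^bsub>H\<^esub>"
    and complete: "Metric_space.mcomplete (carrier H) (hdist H)"

definition closed_subspace :: "'a set \<Rightarrow> 'a hspace \<Rightarrow> bool"
  where "closed_subspace M K \<longleftrightarrow>
    submodule M (ring_of_type_algebra :: complex ring) K \<and> closedin (htopology K) M"

definition orth_compl :: "'a hspace \<Rightarrow> 'a set \<Rightarrow> 'a set"
  where "orth_compl K M = {x \<in> carrier K. \<forall>y\<in>M. cinner K x y = 0}"


section \<open>Bounded operators\<close>

text \<open>
  Operators are extensional functions on the carrier of their domain, so that equality of operators
  is equality of functions. Products are formed with \<^const>\<open>compose\<close>, whose first argument is the
  domain of the product.
\<close>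

definition bop :: "'a hspace \<Rightarrow> 'b hspace \<Rightarrow> ('a \<Rightarrow> 'b) set"
  where "bop H K = {A \<in> carrier H \<rightarrow>\<^sub>E carrier K.
    (\<forall>x\<in>carrier H. \<forall>y\<in>carrier H. A (x \<oplus>\<^bsub>H\<^esub> y) = A x \<oplus>\<^bsub>K\<^esub> A y) \<and>
    (\<forall>c. \<forall>x\<in>carrier H. A (c \<odot>\<^bsub>H\<^esub> x) = c \<odot>\<^bsub>K\<^esub> A x) \<and>
    (\<exists>b. \<forall>x\<in>carrier H. hnorm K (A x) \<le> b * hnorm H x)}"

definition adj :: "'a hspace \<Rightarrow> 'b hspace \<Rightarrow> ('a \<Rightarrow> 'b) \<Rightarrow> ('b \<Rightarrow> 'a)"
  where "adj H K A = (THE B. B \<in> bop K H \<and>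
    (\<forall>x\<in>carrier H. \<forall>y\<in>carrier K. cinner K (A x) y = cinner H x (B y)))"

definition positive_op :: "'a hspace \<Rightarrow> ('a \<Rightarrow> 'a) \<Rightarrow> bool"
  where "positive_op H A \<longleftrightarrow> A \<in> bop H H \<and> (\<forall>x\<in>carrier H. cinner H (A x) x \<in> \<real>\<^sub>\<ge>\<^sub>0)"

definition op_sqrt :: "'a hspace \<Rightarrow> ('a \<Rightarrow> 'a) \<Rightarrow> ('a \<Rightarrow> 'a)"
  where "op_sqrt H A = (THE B. positive_op H B \<and> compose (carrier H) B B = A)"

definition op_abs :: "'a hspace \<Rightarrow> 'b hspace \<Rightarrow> ('a \<Rightarrow> 'b) \<Rightarrow> ('a \<Rightarrow> 'a)"
  where "op_abs H K R = op_sqrt H (compose (carrier H) (adj H K R) R)"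

definition proj :: "'a hspace \<Rightarrow> 'a set \<Rightarrow> ('a \<Rightarrow> 'a)"
  where "proj K M = (\<lambda>x\<in>carrier K. THE y. y \<in> M \<and> x \<ominus>\<^bsub>K\<^esub> y \<in> orth_compl K M)"

text \<open>The operator \<open>I - P\<^sub>M\<close>.\<close>

definition coproj :: "'a hspace \<Rightarrow> 'a set \<Rightarrow> ('a \<Rightarrow> 'a)"
  where "coproj K M = (\<lambda>x\<in>carrier K. x \<ominus>\<^bsub>K\<^esub> proj K M x)"


section \<open>Reduced solutions\<close>

text \<open>
  \<open>D\<close> is the reduced solution of \<open>A X = C\<close>, where \<open>A : H \<rightarrow> K\<close>, \<open>C : E \<rightarrow> K\<close> and \<open>X : E \<rightarrow> H\<close>.
\<close>

definition reduced_solution ::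
    "'e hspace \<Rightarrow> 'a hspace \<Rightarrow> 'b hspace \<Rightarrow> ('a \<Rightarrow> 'b) \<Rightarrow> ('e \<Rightarrow> 'b) \<Rightarrow> ('e \<Rightarrow> 'a) \<Rightarrow> bool"
  where "reduced_solution E H K A C D \<longleftrightarrow>
    A \<in> bop H K \<and> C \<in> bop E K \<and> D \<in> bop E H \<and>
    compose (carrier E) A D = C \<and>
    D ` carrier E \<subseteq> htopology H closure_of (adj H K A ` carrier K)"

definition has_reduced_solution ::
    "'e hspace \<Rightarrow> 'a hspace \<Rightarrow> 'b hspace \<Rightarrow> ('a \<Rightarrow> 'b) \<Rightarrow> ('e \<Rightarrow> 'b) \<Rightarrow> bool"
  where "has_reduced_solution E H K A C \<longleftrightarrow> (\<exists>D. reduced_solution E H K A C D)"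

text \<open>\<open>|R|\<^sup>1\<^sup>/\<^sup>2\<close>, \<open>|R\<^sup>*|\<^sup>1\<^sup>/\<^sup>2\<close> and \<open>V\<^sub>R\<close> for \<open>R : H \<rightarrow> K\<close>.\<close>

definition sqrt_abs :: "'a hspace \<Rightarrow> 'b hspace \<Rightarrow> ('a \<Rightarrow> 'b) \<Rightarrow> ('a \<Rightarrow> 'a)"
  where "sqrt_abs H K R = op_sqrt H (op_abs H K R)"

definition sqrt_abs_adj :: "'a hspace \<Rightarrow> 'b hspace \<Rightarrow> ('a \<Rightarrow> 'b) \<Rightarrow> ('b \<Rightarrow> 'b)"
  where "sqrt_abs_adj H K R = sqrt_abs K H (adj H K R)"

definition V_op :: "'a hspace \<Rightarrow> 'b hspace \<Rightarrow> ('a \<Rightarrow> 'b) \<Rightarrow> ('a \<Rightarrow> 'b)"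
  where "V_op H K R = (THE V. reduced_solution H K K (sqrt_abs_adj H K R) R V)"


section \<open>Complementability\<close>

definition complementable :: "'a hspace \<Rightarrow> 'a set \<Rightarrow> ('a \<Rightarrow> 'a) \<Rightarrow> bool"
  where "complementable K M T \<longleftrightarrow>
    (let Q = coproj K M; mul = compose (carrier K) in
      \<exists>M\<^sub>r\<in>bop K K. \<exists>M\<^sub>l\<in>bop K K.
        mul Q M\<^sub>r = M\<^sub>r \<and> mul M\<^sub>l Q = M\<^sub>l \<and>
        mul Q (mul T M\<^sub>r) = mul Q T \<and> mul M\<^sub>l (mul T Q) = mul T Q)"

definition T12 :: "'a hspace \<Rightarrow> 'a set \<Rightarrow> ('a \<Rightarrow> 'a) \<Rightarrow> ('a \<Rightarrow> 'a)"
  where "T12 K M T = restrict (proj K M \<circ> T \<circ> coproj K M) (orth_compl K M)"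

definition T21 :: "'a hspace \<Rightarrow> 'a set \<Rightarrow> ('a \<Rightarrow> 'a) \<Rightarrow> ('a \<Rightarrow> 'a)"
  where "T21 K M T = restrict (coproj K M \<circ> T \<circ> proj K M) M"

definition T22 :: "'a hspace \<Rightarrow> 'a set \<Rightarrow> ('a \<Rightarrow> 'a) \<Rightarrow> ('a \<Rightarrow> 'a)"
  where "T22 K M T = restrict (coproj K M \<circ> T \<circ> coproj K M) (orth_compl K M)"

definition weakly_complementable :: "'a hspace \<Rightarrow> 'a set \<Rightarrow> ('a \<Rightarrow> 'a) \<Rightarrow> bool"
  where "weakly_complementable K M T \<longleftrightarrow>
    (let H = K\<lparr>carrier := M\<rparr>; N = K\<lparr>carrier := orth_compl K M\<rparr>;
         A12 = T12 K M T; A21 = T21 K M T; A22 = T22 K M T; V = V_op N N A22 in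
      has_reduced_solution H N N V A21 \<and>
      has_reduced_solution H N N (sqrt_abs N N A22) (adj N H A12) \<and>
      has_reduced_solution H N N (sqrt_abs_adj N N A22) A21 \<and>
      has_reduced_solution H N N (adj N N V) (adj N H A12))"

end

theory Submission
  imports Defs "HOL-Analysis.L2_Norm"
begin

text \<open>
  On \<open>K = \<ell>\<^sup>2\<close> with \<open>M = span {e\<^sub>0}\<close> let \<open>T x = D (x + x\<^sub>0 (0, 1, 1, \<dots>))\<close>, where \<open>D\<close> is the diagonal
  operator with entries \<open>0\<close> at index \<open>0\<close> and \<open>4\<^sup>-\<^sup>n\<close> at index \<open>n > 0\<close>. Then \<open>T\<^sub>2\<^sub>2 = D\<close> is positive,
  so that \<open>|T\<^sub>2\<^sub>2|\<^sup>1\<^sup>/\<^sup>2\<close>, \<open>|T\<^sub>2\<^sub>2\<^sup>*|\<^sup>1\<^sup>/\<^sup>2\<close> and \<open>V\<close> all equal \<open>D\<^sup>1\<^sup>/\<^sup>2\<close>, and \<open>T\<^sub>1\<^sub>2 = 0\<close>. The vector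
  \<open>T\<^sub>2\<^sub>1 e\<^sub>0 = D\<^sup>1\<^sup>/\<^sup>2 (2\<^sup>-\<^sup>n)\<^sub>n\<close> lies in the range of \<open>D\<^sup>1\<^sup>/\<^sup>2\<close>, but not in that of \<open>D\<close>: its only formal
  preimage \<open>(1, 1, \<dots>)\<close> is not square summable.
\<close>

section \<open>Square-summable sequences supported on an index set, and their norm\<close>

text \<open>All sequences are indexed by \<open>nat\<close>, and \<open>I\<close> only prescribes a
  support. Thus \<open>l2set I\<close> serves both as the space of sequences over \<open>I\<close>
  and as a coordinate subspace of \<open>l2set UNIV\<close>.\<close>

definition l2set :: "nat set \<Rightarrow> (nat \<Rightarrow> complex) set"
  where "l2set I = {x. summable (\<lambda>n. (cmod (x n))\<^sup>2) \<and> (\<forall>n. n \<notin> I \<longrightarrow> x n = 0)}"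

definition l2norm :: "(nat \<Rightarrow> complex) \<Rightarrow> real"
  where "l2norm x = sqrt (\<Sum>n. (cmod (x n))\<^sup>2)"

text \<open>The index set enters through the carrier alone, so replacing the carrier by a coordinate
  subspace yields literally another \<open>l2\<close> space. The fields \<open>monoid.mult\<close>
  and \<open>one\<close> are dummies.\<close>

definition l2 :: "nat set \<Rightarrow> (nat \<Rightarrow> complex) hspace"
  where "l2 I = \<lparr>carrier = l2set I, monoid.mult = (\<lambda>x y. x), one = (\<lambda>n. 0), ring.zero = (\<lambda>n. 0),
    add = (\<lambda>x y n. x n + y n), module.smult = (\<lambda>c x n. c * x n),
    cinner = (\<lambda>x y. \<Sum>n. x n * cnj (y n))\<rparr>"

lemma l2_simps [simp]:
  "carrier (l2 I) = l2set I"
  "\<zero>\<^bsub>l2 I\<^esub> = (\<lambda>n. 0)"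
  "x \<oplus>\<^bsub>l2 I\<^esub> y = (\<lambda>n. x n + y n)"
  "c \<odot>\<^bsub>l2 I\<^esub> x = (\<lambda>n. c * x n)"
  "cinner (l2 I) x y = (\<Sum>n. x n * cnj (y n))"
  "(l2 J)\<lparr>carrier := l2set I\<rparr> = l2 I"
  by (simp_all add: l2_def)

lemma l2set_summable: "x \<in> l2set I \<Longrightarrow> summable (\<lambda>n. (cmod (x n))\<^sup>2)"
  by (simp add: l2set_def)

lemma l2set_eq_0: "x \<in> l2set I \<Longrightarrow> n \<notin> I \<Longrightarrow> x n = 0"
  by (simp add: l2set_def)

lemma l2set_mono: "x \<in> l2set I \<Longrightarrow> I \<subseteq> J \<Longrightarrow> x \<in> l2set J"
  by (auto simp: l2set_def)

text \<open>Comparison test. The index sets \<open>I\<close> and \<open>J\<close> are independent,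
  so that the lemma also covers cutting a sequence down to a smaller support.\<close>

lemma l2set_dominated:
  assumes "x \<in> l2set J" "\<And>n. cmod (y n) \<le> b * cmod (x n)" "\<And>n. n \<notin> I \<Longrightarrow> y n = 0"
  shows "y \<in> l2set I"
proof -
  have "(cmod (y n))\<^sup>2 \<le> b\<^sup>2 * (cmod (x n))\<^sup>2" for n
    using power_mono[OF assms(2)[of n], of 2] by (simp add: power_mult_distrib)
  then have "summable (\<lambda>n. (cmod (y n))\<^sup>2)"
    by (intro summable_comparison_test'[OF summable_mult[OF l2set_summable[OF assms(1)], of "b\<^sup>2"]])
      auto
  then show ?thesis using assms(3) by (simp add: l2set_def)
qed

lemma l2set_zero [simp]: "(\<lambda>n. 0) \<in> l2set I"
  by (simp add: l2set_def)

lemma l2set_add: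
  assumes "x \<in> l2set I" "y \<in> l2set I"
  shows "(\<lambda>n. x n + y n) \<in> l2set I"
proof -
  have "(cmod (x n + y n))\<^sup>2 \<le> 2 * (cmod (x n))\<^sup>2 + 2 * (cmod (y n))\<^sup>2" for n
  proof -
    have "(cmod (x n + y n))\<^sup>2 \<le> (cmod (x n) + cmod (y n))\<^sup>2"
      by (intro power_mono norm_triangle_ineq) auto
    also have "\<dots> \<le> 2 * (cmod (x n))\<^sup>2 + 2 * (cmod (y n))\<^sup>2"
      using zero_le_power2[of "cmod (x n) - cmod (y n)"] by (simp add: power2_eq_square algebra_simps)
    finally show ?thesis .
  qed
  then have "summable (\<lambda>n. (cmod (x n + y n))\<^sup>2)"
    by (intro summable_comparison_test'[OF summable_add[OF summable_mult[OF l2set_summable[OF assms(1)], of 2]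
          summable_mult[OF l2set_summable[OF assms(2)], of 2]]]) auto
  then show ?thesis using assms by (simp add: l2set_def)
qed

lemma l2set_smult: "x \<in> l2set I \<Longrightarrow> (\<lambda>n. c * x n) \<in> l2set I"
  by (rule l2set_dominated[where b = "cmod c"]) (auto simp: norm_mult l2set_eq_0)

lemma l2set_minus: "x \<in> l2set I \<Longrightarrow> (\<lambda>n. - x n) \<in> l2set I"
  using l2set_smult[of x I "-1"] by simp

lemma l2set_diff: "x \<in> l2set I \<Longrightarrow> y \<in> l2set I \<Longrightarrow> (\<lambda>n. x n - y n) \<in> l2set I"
  using l2set_add[OF _ l2set_minus] by simp

lemma l2set_finite_support:
  assumes "finite F" "\<And>n. n \<notin> F \<Longrightarrow> x n = 0" "\<And>n. n \<notin> I \<Longrightarrow> x n = 0"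
  shows "x \<in> l2set I"
  using assms summable_finite[of F "\<lambda>n. (cmod (x n))\<^sup>2"] by (auto simp: l2set_def)

lemma l2norm_nonneg: "x \<in> l2set I \<Longrightarrow> 0 \<le> l2norm x"
  by (simp add: l2norm_def suminf_nonneg l2set_summable)

text \<open>The squared norm is the supremum of its partial sums. Norm inequalities, together with
  membership in the space, can therefore be proved on finite truncations, where the library results
  on \<open>L2_set\<close> apply.\<close>

lemma l2norm_le_iff:
  assumes "0 \<le> e"
  shows "x \<in> l2set UNIV \<and> l2norm x \<le> e \<longleftrightarrow> (\<forall>N. L2_set (\<lambda>n. cmod (x n)) {..<N} \<le> e)"
    (is "?l \<longleftrightarrow> ?r")
proof
  assume ?l
  show ?r
  proof
    fix N
    have "L2_set (\<lambda>n. cmod (x n)) {..<N} \<le> l2norm x"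
      using sum_le_suminf[OF l2set_summable, of x UNIV "{..<N}"] \<open>?l\<close>
      by (simp add: L2_set_def l2norm_def)
    then show "L2_set (\<lambda>n. cmod (x n)) {..<N} \<le> e" using \<open>?l\<close> by linarith
  qed
next
  assume r: ?r
  have b: "(\<Sum>n<N. (cmod (x n))\<^sup>2) \<le> e\<^sup>2" for N
    using r assms by (simp add: L2_set_def sqrt_le_D)
  have s: "summable (\<lambda>n. (cmod (x n))\<^sup>2)"
    by (intro bounded_imp_summable[where B = "e\<^sup>2"])
      (use b in \<open>auto simp flip: lessThan_Suc_atMost simp del: sum.lessThan_Suc\<close>)
  have "l2norm x \<le> sqrt (e\<^sup>2)"
    unfolding l2norm_def by (intro real_sqrt_le_mono suminf_le_const s b)
  with s assms show ?l by (simp add: l2set_def)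
qed

lemma L2_set_le_l2norm:
  assumes "x \<in> l2set I"
  shows "L2_set (\<lambda>n. cmod (x n)) {..<N} \<le> l2norm x"
  using l2norm_le_iff[OF l2norm_nonneg[OF assms], of x] l2set_mono[OF assms subset_UNIV] by simp

lemma l2norm_triangle:
  assumes "x \<in> l2set I" "y \<in> l2set I"
  shows "l2norm (\<lambda>n. x n + y n) \<le> l2norm x + l2norm y"
proof -
  have "L2_set (\<lambda>n. cmod (x n + y n)) {..<N} \<le> l2norm x + l2norm y" for N
  proof -
    have "L2_set (\<lambda>n. cmod (x n + y n)) {..<N} \<le> L2_set (\<lambda>n. cmod (x n) + cmod (y n)) {..<N}"
      by (intro L2_set_mono norm_triangle_ineq) auto
    also have "\<dots> \<le> L2_set (\<lambda>n. cmod (x n)) {..<N} + L2_set (\<lambda>n. cmod (y n)) {..<N}"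
      by (rule L2_set_triangle_ineq)
    also have "\<dots> \<le> l2norm x + l2norm y"
      by (intro add_mono L2_set_le_l2norm[OF assms(1)] L2_set_le_l2norm[OF assms(2)])
    finally show ?thesis .
  qed
  then show ?thesis
    using l2norm_le_iff[of "l2norm x + l2norm y" "\<lambda>n. x n + y n"] assms[THEN l2norm_nonneg] by simp
qed

lemma norm_le_l2norm:
  assumes "x \<in> l2set I"
  shows "cmod (x n) \<le> l2norm x"
proof -
  have "cmod (x n) \<le> L2_set (\<lambda>n. cmod (x n)) {..<Suc n}"
    by (rule member_le_L2_set) auto
  also have "\<dots> \<le> l2norm x"
    by (rule L2_set_le_l2norm[OF assms])
  finally show ?thesis .
qed

lemma l2norm_dominated:
  assumes "x \<in> l2set I" "\<And>n. cmod (y n) \<le> b * cmod (x n)" "0 \<le> b"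
  shows "l2norm y \<le> b * l2norm x"
proof -
  have "L2_set (\<lambda>n. cmod (y n)) {..<N} \<le> b * l2norm x" for N
  proof -
    have "L2_set (\<lambda>n. cmod (y n)) {..<N} \<le> L2_set (\<lambda>n. b * cmod (x n)) {..<N}"
      by (intro L2_set_mono assms) auto
    also have "\<dots> = b * L2_set (\<lambda>n. cmod (x n)) {..<N}"
      using assms(3) by (simp add: L2_set_right_distrib)
    also have "\<dots> \<le> b * l2norm x"
      by (intro mult_left_mono L2_set_le_l2norm[OF assms(1)] assms(3))
    finally show ?thesis .
  qed
  then show ?thesis using l2norm_le_iff[of "b * l2norm x" y] assms(3) l2norm_nonneg[OF assms(1)] by simp
qed

lemma l2norm_eq_0:
  assumes "x \<in> l2set I" "l2norm x = 0"
  shows "x = (\<lambda>n. 0)"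
proof
  fix n
  show "x n = 0"
    using norm_le_l2norm[OF assms(1), of n] assms(2) by simp
qed

section \<open>Inner product and Hilbert space structure\<close>

lemma l2_inner_summable:
  assumes "x \<in> l2set I" "y \<in> l2set J"
  shows "summable (\<lambda>n. x n * cnj (y n))"
proof (rule summable_comparison_test')
  show "summable (\<lambda>n. (cmod (x n))\<^sup>2 + (cmod (y n))\<^sup>2)"
    using assms by (intro summable_add l2set_summable)
  show "norm (x n * cnj (y n)) \<le> (cmod (x n))\<^sup>2 + (cmod (y n))\<^sup>2" for n
  proof -
    have "2 * (cmod (x n) * cmod (y n)) \<le> (cmod (x n))\<^sup>2 + (cmod (y n))\<^sup>2"
      using sum_squares_bound[of "cmod (x n)" "cmod (y n)"] by (simp add: mult.assoc)
    moreover have "0 \<le> cmod (x n) * cmod (y n)" by simp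
    ultimately show ?thesis unfolding norm_mult complex_mod_cnj by linarith
  qed
qed

lemma l2_inner_self:
  assumes "x \<in> l2set I"
  shows "(\<Sum>n. x n * cnj (x n)) = of_real ((l2norm x)\<^sup>2)"
proof -
  have "(\<Sum>n. x n * cnj (x n)) = (\<Sum>n. of_real ((cmod (x n))\<^sup>2))"
    by (simp add: complex_norm_square del: of_real_power)
  also have "\<dots> = of_real (\<Sum>n. (cmod (x n))\<^sup>2)"
    by (rule suminf_of_real[symmetric]) (rule l2set_summable[OF assms])
  finally show ?thesis
    by (simp add: l2norm_def suminf_nonneg[OF l2set_summable[OF assms]])
qed

lemma hnorm_l2: "x \<in> l2set I \<Longrightarrow> hnorm (l2 I) x = l2norm x"
  by (simp add: hnorm_def l2_inner_self l2norm_nonneg del: of_real_power)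

lemma abelian_group_l2: "abelian_group (l2 I)"
proof (rule abelian_groupI)
  fix x assume "x \<in> carrier (l2 I)"
  then show "\<exists>y\<in>carrier (l2 I). y \<oplus>\<^bsub>l2 I\<^esub> x = \<zero>\<^bsub>l2 I\<^esub>"
    by (intro bexI[where x = "\<lambda>n. - x n"]) (auto intro: l2set_minus)
qed (auto intro: l2set_add simp: algebra_simps)

lemma module_l2: "Module.module (ring_of_type_algebra :: complex ring) (l2 I)"
proof (rule moduleI)
  show "cring (ring_of_type_algebra :: complex ring)" ..
qed (auto intro: abelian_group_l2 l2set_smult simp: ring_of_type_algebra_def algebra_simps)

lemma l2_uminus: "x \<in> l2set I \<Longrightarrow> \<ominus>\<^bsub>l2 I\<^esub> x = (\<lambda>n. - x n)"
  by (rule abelian_group.minus_equality[OF abelian_group_l2]) (auto intro: l2set_minus)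

lemma l2_minus: "y \<in> l2set I \<Longrightarrow> x \<ominus>\<^bsub>l2 I\<^esub> y = (\<lambda>n. x n - y n)"
  by (simp add: a_minus_def l2_uminus)

lemma hdist_l2:
  assumes "x \<in> l2set I" "y \<in> l2set I"
  shows "hdist (l2 I) x y = l2norm (\<lambda>n. x n - y n)"
  using assms by (simp add: hdist_def l2_minus hnorm_l2 l2set_diff)

lemma Metric_space_l2: "Metric_space (l2set I) (hdist (l2 I))"
proof
  fix x y
  show "0 \<le> hdist (l2 I) x y"
    using l2norm_nonneg[OF l2set_diff] by (auto simp: hdist_def l2_minus hnorm_l2 l2set_diff)
  have "l2norm (\<lambda>n. x n - y n) = l2norm (\<lambda>n. y n - x n)"
    by (simp add: l2norm_def norm_minus_commute)
  then show "hdist (l2 I) x y = hdist (l2 I) y x"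
    by (simp add: hdist_def l2_minus hnorm_l2 l2set_diff)
next
  fix x y assume *: "x \<in> l2set I" "y \<in> l2set I"
  show "hdist (l2 I) x y = 0 \<longleftrightarrow> x = y"
  proof
    assume "hdist (l2 I) x y = 0"
    then have "(\<lambda>n. x n - y n) = (\<lambda>n. 0)"
      using * by (intro l2norm_eq_0[OF l2set_diff[OF *]]) (simp add: hdist_l2)
    then show "x = y" by (simp add: fun_eq_iff)
  next
    assume "x = y"
    then show "hdist (l2 I) x y = 0" using * by (simp add: hdist_l2 l2norm_def)
  qed
next
  fix x y z assume "x \<in> l2set I" "y \<in> l2set I" "z \<in> l2set I"
  then show "hdist (l2 I) x z \<le> hdist (l2 I) x y + hdist (l2 I) y z"
    using l2norm_triangle[of "\<lambda>n. x n - y n" I "\<lambda>n. y n - z n"] by (simp add: hdist_l2 l2set_diff)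
qed

text \<open>A Cauchy sequence converges in every coordinate. The Cauchy estimate holds for each
  finite truncation, where it passes to the coordinatewise limit; letting the truncation grow gives
  convergence in norm.\<close>

lemma l2_complete: "Metric_space.mcomplete (l2set I) (hdist (l2 I))"
proof -
  interpret Metric_space "l2set I" "hdist (l2 I)" by (rule Metric_space_l2)
  show ?thesis
    unfolding mcomplete_def
  proof (intro allI impI)
    fix s assume "MCauchy s"
    then have s: "\<And>k. s k \<in> l2set I"
      and c: "\<And>e. 0 < e \<Longrightarrow> \<exists>N. \<forall>k\<ge>N. \<forall>m\<ge>N. l2norm (\<lambda>n. s k n - s m n) < e"
      unfolding MCauchy_def by (auto simp: hdist_l2 image_subset_iff)
    have "convergent (\<lambda>k. s k n)" for n
    proof (rule Cauchy_convergent, rule metric_CauchyI)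
      fix e :: real assume "0 < e"
      with c obtain N where N: "\<forall>k\<ge>N. \<forall>m\<ge>N. l2norm (\<lambda>n. s k n - s m n) < e" by blast
      have "dist (s k n) (s m n) < e" if "k \<ge> N" "m \<ge> N" for k m
        using norm_le_l2norm[OF l2set_diff[OF s[of k] s[of m]], of n] N that
        unfolding dist_norm by (meson le_less_trans)
      then show "\<exists>N. \<forall>k\<ge>N. \<forall>m\<ge>N. dist (s k n) (s m n) < e" by blast
    qed
    then obtain a where a: "\<And>n. (\<lambda>k. s k n) \<longlonglongrightarrow> a n"
      unfolding convergent_def by metis
    have lim: "\<exists>N. \<forall>k\<ge>N. (\<lambda>n. s k n - a n) \<in> l2set UNIV \<and> l2norm (\<lambda>n. s k n - a n) \<le> e"
      if e: "0 < e" for e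
    proof -
      obtain N where N: "\<And>k m. k \<ge> N \<Longrightarrow> m \<ge> N \<Longrightarrow> l2norm (\<lambda>n. s k n - s m n) < e"
        using c[OF e] by blast
      \<comment> \<open>The truncation length \<open>j\<close> is fixed while \<open>m\<close> tends
        to infinity, so only finitely many coordinate limits are involved, and \<open>N\<close> does
        not depend on \<open>j\<close>.\<close>
      have "L2_set (\<lambda>n. cmod (s k n - a n)) {..<j} \<le> e" if "k \<ge> N" for k j
      proof (rule LIMSEQ_le_const2)
        show "(\<lambda>m. L2_set (\<lambda>n. cmod (s k n - s m n)) {..<j})
            \<longlonglongrightarrow> L2_set (\<lambda>n. cmod (s k n - a n)) {..<j}"
          unfolding L2_set_def by (intro tendsto_intros a)
        have "L2_set (\<lambda>n. cmod (s k n - s m n)) {..<j} \<le> e" if "m \<ge> N" for m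
          using l2norm_le_iff[of e "\<lambda>n. s k n - s m n"] e N[OF \<open>k \<ge> N\<close> that]
            l2set_mono[OF l2set_diff[OF s s] subset_UNIV] by (simp add: less_imp_le)
        then show "\<exists>M. \<forall>m\<ge>M. L2_set (\<lambda>n. cmod (s k n - s m n)) {..<j} \<le> e" by blast
      qed
      then show ?thesis using l2norm_le_iff[of e] e by (meson less_imp_le)
    qed
    \<comment> \<open>The limit is the difference of \<open>s k\<close> and \<open>s k - a\<close>,
      both of which are square summable.\<close>
    have "a \<in> l2set I"
    proof -
      obtain k where "(\<lambda>n. s k n - a n) \<in> l2set UNIV" using lim[of 1] by auto
      from l2set_diff[OF l2set_mono[OF s[of k] subset_UNIV] this] have "a \<in> l2set UNIV" by simp
      moreover have "a n = 0" if "n \<notin> I" for n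
        using LIMSEQ_unique[OF a[of n]] l2set_eq_0[OF s that] by simp
      ultimately show ?thesis by (simp add: l2set_def)
    qed
    moreover have "\<exists>N. \<forall>k\<ge>N. s k \<in> l2set I \<and> hdist (l2 I) (s k) a < e" if "e > 0" for e
      using lim[of "e/2"] that s \<open>a \<in> l2set I\<close> by (fastforce simp: hdist_l2)
    ultimately show "\<exists>x. limitin mtopology s x sequentially"
      by (auto simp: limit_metric_sequentially)
  qed
qed

lemma hilbert_space_l2: "hilbert_space (l2 I)"
proof (intro hilbert_space.intro hilbert_space_axioms.intro module_l2)
  fix x y z and c :: complex
  assume "x \<in> carrier (l2 I)" "y \<in> carrier (l2 I)"
  then have x: "x \<in> l2set I" and y: "y \<in> l2set I" by auto
  show "cinner (l2 I) (c \<odot>\<^bsub>l2 I\<^esub> x) y = c * cinner (l2 I) x y"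
    using suminf_mult[OF l2_inner_summable[OF x y], of c] by (simp add: mult.assoc)
  show "cinner (l2 I) x y = cnj (cinner (l2 I) y x)"
    using bounded_linear.suminf[OF bounded_linear_cnj l2_inner_summable[OF y x]]
    by (simp add: mult.commute)
  assume "z \<in> carrier (l2 I)"
  then have z: "z \<in> l2set I" by simp
  show "cinner (l2 I) (x \<oplus>\<^bsub>l2 I\<^esub> y) z = cinner (l2 I) x z + cinner (l2 I) y z"
    using suminf_add[OF l2_inner_summable[OF x z] l2_inner_summable[OF y z]]
    by (simp add: distrib_right)
next
  fix x assume "x \<in> carrier (l2 I)"
  then have x: "x \<in> l2set I" by simp
  then show "cinner (l2 I) x x \<in> \<real>\<^sub>\<ge>\<^sub>0"
    by (simp add: l2_inner_self nonneg_Reals_of_real_iff del: of_real_power)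
  show "x = \<zero>\<^bsub>l2 I\<^esub>" if "cinner (l2 I) x x = 0"
    using that l2norm_eq_0[OF x] by (simp add: l2_inner_self[OF x])
next
  show "Metric_space.mcomplete (carrier (l2 I)) (hdist (l2 I))"
    using l2_complete by simp
qed

section \<open>Bounded operators, adjoints and positivity\<close>

lemma bop_l2_iff:
  "A \<in> bop (l2 I) (l2 J) \<longleftrightarrow> A \<in> l2set I \<rightarrow>\<^sub>E l2set J \<and>
    (\<forall>x\<in>l2set I. \<forall>y\<in>l2set I. A (\<lambda>n. x n + y n) = (\<lambda>n. A x n + A y n)) \<and>
    (\<forall>c. \<forall>x\<in>l2set I. A (\<lambda>n. c * x n) = (\<lambda>n. c * A x n)) \<and>
    (\<exists>b. \<forall>x\<in>l2set I. l2norm (A x) \<le> b * l2norm x)"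
proof -
  have "hnorm (l2 J) (A x) = l2norm (A x)" "hnorm (l2 I) x = l2norm x"
    if "A \<in> l2set I \<rightarrow>\<^sub>E l2set J" "x \<in> l2set I" for x
    using that by (auto intro: hnorm_l2 PiE_mem)
  then show ?thesis by (simp add: bop_def cong: conj_cong)
qed

lemma bop_l2I:
  assumes "A \<in> extensional (l2set I)" "\<And>x. x \<in> l2set I \<Longrightarrow> A x \<in> l2set J"
    "\<And>x y. x \<in> l2set I \<Longrightarrow> y \<in> l2set I \<Longrightarrow> A (\<lambda>n. x n + y n) = (\<lambda>n. A x n + A y n)"
    "\<And>c x. x \<in> l2set I \<Longrightarrow> A (\<lambda>n. c * x n) = (\<lambda>n. c * A x n)"
    "\<And>x. x \<in> l2set I \<Longrightarrow> l2norm (A x) \<le> b * l2norm x"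
  shows "A \<in> bop (l2 I) (l2 J)"
  unfolding bop_l2_iff using assms by (intro conjI ballI allI exI[where x = b]) (auto simp: PiE_iff)

lemma bop_l2_mem: "A \<in> bop (l2 I) (l2 J) \<Longrightarrow> x \<in> l2set I \<Longrightarrow> A x \<in> l2set J"
  by (auto simp: bop_l2_iff PiE_iff)

lemma bop_l2_smult:
  "A \<in> bop (l2 I) (l2 J) \<Longrightarrow> x \<in> l2set I \<Longrightarrow> A (\<lambda>n. c * x n) = (\<lambda>n. c * A x n)"
  by (auto simp: bop_l2_iff)

lemma bop_l2_eqI:
  assumes "A \<in> bop (l2 I) (l2 J)" "B \<in> bop (l2 I) (l2 J)" "\<And>x. x \<in> l2set I \<Longrightarrow> A x = B x"
  shows "A = B"
proof (rule PiE_ext)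
  show "A \<in> l2set I \<rightarrow>\<^sub>E l2set J" "B \<in> l2set I \<rightarrow>\<^sub>E l2set J"
    using assms(1,2) unfolding bop_l2_iff by blast+
qed (rule assms(3))

definition l2unit :: "nat \<Rightarrow> nat \<Rightarrow> complex"
  where "l2unit k = (\<lambda>n. if n = k then 1 else 0)"

lemma l2unit_in [simp]: "k \<in> I \<Longrightarrow> l2unit k \<in> l2set I"
  by (rule l2set_finite_support[of "{k}"]) (auto simp: l2unit_def)

lemma l2unit_inner [simp]:
  "(\<Sum>n. x n * cnj (l2unit k n)) = x k" "(\<Sum>n. l2unit k n * cnj (x n)) = cnj (x k)"
proof -
  have "(\<Sum>n. x n * cnj (l2unit k n)) = (\<Sum>n\<in>{k}. x n * cnj (l2unit k n))"
    by (rule suminf_finite) (auto simp: l2unit_def)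
  then show "(\<Sum>n. x n * cnj (l2unit k n)) = x k" by (simp add: l2unit_def)
  have "(\<Sum>n. l2unit k n * cnj (x n)) = (\<Sum>n\<in>{k}. l2unit k n * cnj (x n))"
    by (rule suminf_finite) (auto simp: l2unit_def)
  then show "(\<Sum>n. l2unit k n * cnj (x n)) = cnj (x k)" by (simp add: l2unit_def)
qed

text \<open>Testing against unit vectors determines every coordinate of \<open>B y\<close> inside
  \<open>I\<close>, and the others vanish. This gives the uniqueness that the definite description
  in \<open>adj\<close> requires.\<close>

lemma adj_l2_eqI:
  assumes B: "B \<in> bop (l2 J) (l2 I)"
    and adj: "\<And>x y. x \<in> l2set I \<Longrightarrow> y \<in> l2set J \<Longrightarrow>
      (\<Sum>n. A x n * cnj (y n)) = (\<Sum>n. x n * cnj (B y n))"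
  shows "adj (l2 I) (l2 J) A = B"
  unfolding adj_def
proof (rule the_equality)
  show "B \<in> bop (l2 J) (l2 I) \<and> (\<forall>x\<in>carrier (l2 I). \<forall>y\<in>carrier (l2 J).
      cinner (l2 J) (A x) y = cinner (l2 I) x (B y))"
    using B adj by simp
next
  fix C
  assume C: "C \<in> bop (l2 J) (l2 I) \<and> (\<forall>x\<in>carrier (l2 I). \<forall>y\<in>carrier (l2 J).
      cinner (l2 J) (A x) y = cinner (l2 I) x (C y))"
  show "C = B"
  proof (rule bop_l2_eqI)
    fix y assume y: "y \<in> l2set J"
    show "C y = B y"
    proof
      fix n
      show "C y n = B y n"
      proof (cases "n \<in> I")
        case True
        have "(\<Sum>m. l2unit n m * cnj (C y m)) = (\<Sum>m. l2unit n m * cnj (B y m))"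
          using C adj[OF l2unit_in[OF True] y] y True by simp
        then show ?thesis by simp
      next
        case False
        then show ?thesis
          using C B y l2set_eq_0[OF bop_l2_mem] by metis
      qed
    qed
  qed (use B C in auto)
qed

text \<open>Polarization: the quadratic form of \<open>B\<close> is real at \<open>x + c y\<close>
  for every scalar \<open>c\<close>. The symmetry is what later allows a positive square root to be
  moved onto unit vectors.\<close>

lemma (in hilbert_space) positive_op_hermitian:
  assumes "positive_op H B" and x: "x \<in> carrier H" and y: "y \<in> carrier H"
  shows "cinner H (B x) y = cinner H x (B y)"
proof -
  have B: "\<And>z. z \<in> carrier H \<Longrightarrow> B z \<in> carrier H"
    "\<And>u v. u \<in> carrier H \<Longrightarrow> v \<in> carrier H \<Longrightarrow> B (u \<oplus>\<^bsub>H\<^esub> v) = B u \<oplus>\<^bsub>H\<^esub> B v"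
    "\<And>c u. u \<in> carrier H \<Longrightarrow> B (c \<odot>\<^bsub>H\<^esub> u) = c \<odot>\<^bsub>H\<^esub> B u"
    and pos: "\<And>z. z \<in> carrier H \<Longrightarrow> Im (cinner H (B z) z) = 0"
    using assms(1) by (auto simp: positive_op_def bop_def PiE_iff nonneg_Reals_def)
  have sm: "c \<odot>\<^bsub>H\<^esub> u \<in> carrier H" if "u \<in> carrier H" for c u
    using smult_closed[of c u] that by (simp add: ring_of_type_algebra_def)
  have add_right: "cinner H u (v \<oplus>\<^bsub>H\<^esub> w) = cinner H u v + cinner H u w"
    if "u \<in> carrier H" "v \<in> carrier H" "w \<in> carrier H" for u v w
    using that by (simp add: cinner_commute[of u] cinner_add_left)
  have smult_right: "cinner H u (c \<odot>\<^bsub>H\<^esub> v) = cnj c * cinner H u v"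
    if "u \<in> carrier H" "v \<in> carrier H" for u v c
    using that by (simp add: cinner_commute[of u] cinner_smult_left sm)
  have "Im (cinner H (B x) x + cnj c * cinner H (B x) y + c * cinner H (B y) x
      + c * cnj c * cinner H (B y) y) = 0" for c
    using pos[of "x \<oplus>\<^bsub>H\<^esub> c \<odot>\<^bsub>H\<^esub> y"] x y
    by (simp add: B sm cinner_add_left cinner_smult_left add_right smult_right algebra_simps)
  \<comment> \<open>The choice \<open>c = 1\<close> compares the imaginary parts of the two mixed
    terms, the choice \<open>c = \<i>\<close> their real parts.\<close>
  from this[of 1] this[of \<i>]
  have "cinner H (B x) y = cnj (cinner H (B y) x)"
    using pos x y by (simp add: complex_eq_iff)
  also have "\<dots> = cinner H x (B y)"
    using cinner_commute x y B by metis
  finally show ?thesis .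
qed

section \<open>Diagonal operators and their square roots\<close>

text \<open>Real entries make the operator its own adjoint. Values of \<open>d\<close> off
  \<open>I\<close> have no effect, since the sequences vanish there; the restriction provides the
  extensionality demanded by \<open>bop\<close>.\<close>

definition diag :: "nat set \<Rightarrow> (nat \<Rightarrow> real) \<Rightarrow> (nat \<Rightarrow> complex) \<Rightarrow> nat \<Rightarrow> complex"
  where "diag I d = (\<lambda>x\<in>l2set I. \<lambda>n. of_real (d n) * x n)"

lemma diag_apply: "x \<in> l2set I \<Longrightarrow> diag I d x = (\<lambda>n. of_real (d n) * x n)"
  by (simp add: diag_def)

lemma diag_bop:
  assumes "\<And>n. \<bar>d n\<bar> \<le> 1"
  shows "diag I d \<in> bop (l2 I) (l2 I)"
proof -
  have le: "cmod (of_real (d n) * x n) \<le> 1 * cmod (x n)" for x n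
    using mult_right_mono[OF assms[of n] norm_ge_zero[of "x n"]] by (simp add: norm_mult)
  show ?thesis
  proof (rule bop_l2I[where b = 1])
    fix x assume x: "x \<in> l2set I"
    have "(\<lambda>n. of_real (d n) * x n) \<in> l2set I"
      by (rule l2set_dominated[OF x, where b = 1]) (use le in \<open>auto simp: l2set_eq_0[OF x]\<close>)
    then show "diag I d x \<in> l2set I" by (simp add: diag_apply x)
    show "l2norm (diag I d x) \<le> 1 * l2norm x"
      by (rule l2norm_dominated[OF x]) (use le in \<open>auto simp: diag_apply x\<close>)
  qed (auto simp: diag_def l2set_add l2set_smult algebra_simps)
qed

lemma compose_diag:
  assumes "\<And>n. \<bar>d n\<bar> \<le> 1"
  shows "compose (l2set I) (diag I c) (diag I d) = diag I (\<lambda>n. c n * d n)"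
proof
  fix x
  show "compose (l2set I) (diag I c) (diag I d) x = diag I (\<lambda>n. c n * d n) x"
    using bop_l2_mem[OF diag_bop[OF assms]]
    by (cases "x \<in> l2set I") (auto simp: compose_def diag_def mult.assoc)
qed

lemma adj_diag:
  assumes "\<And>n. \<bar>d n\<bar> \<le> 1"
  shows "adj (l2 I) (l2 I) (diag I d) = diag I d"
  by (rule adj_l2_eqI) (auto simp: diag_apply diag_bop[OF assms] mult_ac)

lemma positive_diag:
  assumes "\<And>n. 0 \<le> d n" "\<And>n. d n \<le> 1"
  shows "positive_op (l2 I) (diag I d)"
  unfolding positive_op_def
proof (intro conjI ballI)
  show b: "diag I d \<in> bop (l2 I) (l2 I)"
    by (rule diag_bop) (simp add: assms)
  fix x assume "x \<in> carrier (l2 I)"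
  then have x: "x \<in> l2set I" by simp
  have eq: "diag I d x n * cnj (x n) = of_real (d n * (cmod (x n))\<^sup>2)" for n
    using x by (simp add: diag_apply complex_norm_square mult.assoc del: of_real_power)
  have "summable (\<lambda>n. d n * (cmod (x n))\<^sup>2)"
    by (rule summable_comparison_test'[OF l2set_summable[OF x]])
      (simp add: assms abs_mult mult_left_le_one_le)
  then have "(\<Sum>n. diag I d x n * cnj (x n)) = of_real (\<Sum>n. d n * (cmod (x n))\<^sup>2)"
    and "0 \<le> (\<Sum>n. d n * (cmod (x n))\<^sup>2)"
    unfolding eq by (simp_all only: suminf_of_real) (auto intro!: suminf_nonneg simp: assms)
  then show "cinner (l2 I) (diag I d x) x \<in> \<real>\<^sub>\<ge>\<^sub>0" by simp
qed

text \<open>A square root of a diagonal operator commutes with it. As the diagonal entries are distinct,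
  it maps every unit vector to a multiple of itself.\<close>

lemma op_sqrt_diag:
  assumes d: "\<And>n. 0 \<le> d n" "\<And>n. d n \<le> 1" and inj: "inj_on d I"
  shows "op_sqrt (l2 I) (diag I d) = diag I (\<lambda>n. sqrt (d n))"
  unfolding op_sqrt_def
proof (rule the_equality)
  show "positive_op (l2 I) (diag I (\<lambda>n. sqrt (d n))) \<and>
    compose (carrier (l2 I)) (diag I (\<lambda>n. sqrt (d n))) (diag I (\<lambda>n. sqrt (d n))) = diag I d"
    by (auto simp: compose_diag positive_diag d)
next
  fix B
  assume "positive_op (l2 I) B \<and> compose (carrier (l2 I)) B B = diag I d"
  then have pos: "positive_op (l2 I) B" and "compose (l2set I) B B = diag I d" by auto
  then have B: "B \<in> bop (l2 I) (l2 I)" and BB: "\<And>x. x \<in> l2set I \<Longrightarrow> B (B x) = diag I d x"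
    by (auto simp: positive_op_def dest: compose_eq[of _ "l2set I" B B])
  have unit: "B (l2unit k) = (\<lambda>n. of_real (sqrt (d k)) * l2unit k n)" if k: "k \<in> I" for k
  proof -
    let ?u = "B (l2unit k)"
    have u: "?u \<in> l2set I" by (rule bop_l2_mem[OF B l2unit_in[OF k]])
    have dk: "diag I d (l2unit k) = (\<lambda>n. of_real (d k) * l2unit k n)"
      by (simp add: diag_apply k) (simp add: l2unit_def fun_eq_iff)
    have "diag I d ?u = B (diag I d (l2unit k))"
      using BB[OF u] BB[OF l2unit_in[OF k]] by simp
    also have "\<dots> = (\<lambda>n. of_real (d k) * ?u n)"
      using bop_l2_smult[OF B l2unit_in[OF k]] dk by simp
    finally have comm: "of_real (d n) * ?u n = of_real (d k) * ?u n" for n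
      using u by (simp add: diag_apply fun_eq_iff)
    have "?u n = 0" if "n \<noteq> k" for n
    proof (cases "n \<in> I")
      case True
      with inj k that have "d n \<noteq> d k" by (auto dest: inj_onD)
      with comm[of n] show ?thesis by auto
    qed (simp add: l2set_eq_0[OF u])
    then have eq: "?u = (\<lambda>n. ?u k * l2unit k n)"
      by (auto simp: l2unit_def)
    have "(\<lambda>n. ?u k * ?u n) = B ?u"
      using bop_l2_smult[OF B l2unit_in[OF k], of "?u k"] eq by simp
    also have "\<dots> = (\<lambda>n. of_real (d k) * l2unit k n)"
      using BB[OF l2unit_in[OF k]] dk by simp
    finally have sq: "?u k * ?u k = of_real (d k)"
      by (metis (no_types, lifting) l2unit_def mult.right_neutral)
    \<comment> \<open>Squaring determines the eigenvalue up to sign; positivity of \<open>B\<close>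
      selects the nonnegative root.\<close>
    have "?u k \<in> \<real>\<^sub>\<ge>\<^sub>0"
      using pos l2unit_in[OF k] unfolding positive_op_def by force
    then obtain b where b: "?u k = of_real b" "0 \<le> b"
      by (auto elim!: nonneg_Reals_cases)
    with sq have "b = sqrt (d k)"
      by (metis of_real_eq_iff of_real_mult real_sqrt_mult_self real_sqrt_abs2 abs_of_nonneg)
    with eq b show ?thesis by simp
  qed
  show "B = diag I (\<lambda>n. sqrt (d n))"
  proof (rule bop_l2_eqI[OF B])
    show "diag I (\<lambda>n. sqrt (d n)) \<in> bop (l2 I) (l2 I)"
      by (rule diag_bop) (simp add: d)
    fix x assume x: "x \<in> l2set I"
    have "B x n = of_real (sqrt (d n)) * x n" for n
    proof (cases "n \<in> I")
      case True
      \<comment> \<open>Symmetry of \<open>B\<close> reduces the \<open>n\<close>-th coordinate of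
        \<open>B x\<close> to the known vector \<open>B (l2unit n)\<close>, so no continuity or
        density argument is needed to pass from unit vectors to all \<open>x\<close>.\<close>
      have "B x n = (\<Sum>m. x m * cnj (B (l2unit n) m))"
        using hilbert_space.positive_op_hermitian[OF hilbert_space_l2 pos, of x "l2unit n"] x True
        by simp
      also have "\<dots> = (\<Sum>m. of_real (sqrt (d n)) * (x m * cnj (l2unit n m)))"
        by (simp add: unit[OF True] mult_ac)
      also have "\<dots> = of_real (sqrt (d n)) * x n"
        by (subst suminf_mult) (use l2_inner_summable[OF x l2unit_in[OF True]] in auto)
      finally show ?thesis .
    next
      case False
      then show ?thesis using l2set_eq_0[OF bop_l2_mem[OF B x]] l2set_eq_0[OF x] by simp
    qed
    then show "B x = diag I (\<lambda>n. sqrt (d n)) x"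
      using x by (auto simp: diag_apply)
  qed
qed

lemma sqrt_abs_diag:
  assumes d: "\<And>n. 0 \<le> d n" "\<And>n. d n \<le> 1" and inj: "inj_on d I"
  shows "sqrt_abs (l2 I) (l2 I) (diag I d) = diag I (\<lambda>n. sqrt (d n))"
    and "sqrt_abs_adj (l2 I) (l2 I) (diag I d) = diag I (\<lambda>n. sqrt (d n))"
proof -
  have *: "\<bar>d n\<bar> \<le> 1" for n using d by simp
  have "op_abs (l2 I) (l2 I) (diag I d) = op_sqrt (l2 I) (diag I (\<lambda>n. d n * d n))"
    by (simp add: op_abs_def adj_diag[OF *] compose_diag[OF *])
  \<comment> \<open>Distinct nonnegative entries have distinct squares, so
    \<open>op_sqrt_diag\<close> applies to the squared operator as well.\<close>
  also have "\<dots> = diag I (\<lambda>n. sqrt (d n * d n))"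
    by (rule op_sqrt_diag)
      (use d inj in \<open>auto simp: power_le_one inj_on_def simp flip: power2_eq_square\<close>)
  also have "\<dots> = diag I d" using d by simp
  finally show "sqrt_abs (l2 I) (l2 I) (diag I d) = diag I (\<lambda>n. sqrt (d n))"
    using assms by (simp add: sqrt_abs_def op_sqrt_diag)
  then show "sqrt_abs_adj (l2 I) (l2 I) (diag I d) = diag I (\<lambda>n. sqrt (d n))"
    by (simp add: sqrt_abs_adj_def adj_diag[OF *])
qed

section \<open>Reduced solutions for diagonal operators\<close>

text \<open>Truncations of \<open>z\<close> approximate it, because the tails of its squared norm
  tend to zero. Each truncation has a preimage with finite support, so dividing by the entries is
  harmless even if they accumulate at \<open>0\<close>.\<close>

lemma diag_range_dense:
  assumes d: "\<And>n. n \<in> I \<Longrightarrow> d n \<noteq> 0" and z: "z \<in> l2set I"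
  shows "z \<in> Abstract_Topology.closure_of (htopology (l2 I)) (diag I d ` l2set I)"
proof -
  interpret Metric_space "l2set I" "hdist (l2 I)" by (rule Metric_space_l2)
  have "\<exists>y\<in>diag I d ` l2set I. y \<in> mball z r" if r: "0 < r" for r
  proof -
    let ?f = "\<lambda>n. (cmod (z n))\<^sup>2"
    obtain N where N: "norm (\<Sum>i. ?f (i + N)) < r\<^sup>2"
      using suminf_exist_split[OF _ l2set_summable[OF z], of "r\<^sup>2"] r by auto
    define y where "y = (\<lambda>n. if n < N then z n else 0)"
    define x where "x = (\<lambda>n. if n < N then z n / of_real (d n) else 0)"
    have x: "x \<in> l2set I"
      by (rule l2set_finite_support[of "{..<N}"]) (auto simp: x_def l2set_eq_0[OF z])
    have "y = diag I d x"
      unfolding diag_apply[OF x] using d l2set_eq_0[OF z] by (fastforce simp: x_def y_def)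
    then have yr: "y \<in> diag I d ` l2set I" using x by blast
    have y: "y \<in> l2set I"
      by (rule l2set_finite_support[of "{..<N}"]) (auto simp: y_def l2set_eq_0[OF z])
    have "(\<Sum>n. (cmod (z n - y n))\<^sup>2) = (\<Sum>i. ?f (i + N))"
      using suminf_split_initial_segment[OF l2set_summable[OF l2set_diff[OF z y]], of N]
      by (simp add: y_def)
    with N have "l2norm (\<lambda>n. z n - y n) < r"
      unfolding l2norm_def using r by (simp add: real_less_lsqrt)
    with yr y z show ?thesis by (auto simp: in_mball hdist_l2)
  qed
  then show ?thesis
    using z by (simp add: htopology_def metric_closure_of)
qed

text \<open>The operator is its own adjoint and has dense range, so the range condition holds for
  every \<open>D\<close> into \<open>l2 I\<close>. It remains to solve the equation coordinate by
  coordinate.\<close>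

lemma reduced_solution_diagI:
  assumes d: "\<And>n. \<bar>d n\<bar> \<le> 1" "\<And>n. n \<in> I \<Longrightarrow> d n \<noteq> 0"
    and D: "D \<in> bop (l2 J) (l2 I)" and C: "C \<in> bop (l2 J) (l2 I)"
    and eq: "\<And>x n. x \<in> l2set J \<Longrightarrow> of_real (d n) * D x n = C x n"
  shows "reduced_solution (l2 J) (l2 I) (l2 I) (diag I d) C D"
  unfolding reduced_solution_def
proof (intro conjI)
  show "diag I d \<in> bop (l2 I) (l2 I)" using d(1) by (rule diag_bop)
  have "C \<in> extensional (l2set J)" using C by (auto simp: bop_l2_iff PiE_iff)
  then show "compose (carrier (l2 J)) (diag I d) D = C"
    using bop_l2_mem[OF D] eq
    by (auto simp: compose_def diag_apply restrict_def extensional_def fun_eq_iff)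
  show "D ` carrier (l2 J) \<subseteq> Abstract_Topology.closure_of (htopology (l2 I))
      (adj (l2 I) (l2 I) (diag I d) ` carrier (l2 I))"
    using bop_l2_mem[OF D] by (auto simp: adj_diag[OF d(1)] intro!: diag_range_dense d)
qed (rule D C)+

text \<open>The square root \<open>S\<close> of the diagonal operator satisfies
  \<open>S S = diag I d\<close>, hence solves the system defining \<open>V_op\<close>; its entries
  on \<open>I\<close> are nonzero and can be cancelled, which gives uniqueness.\<close>

lemma V_op_diag:
  assumes d: "\<And>n. 0 \<le> d n" "\<And>n. d n \<le> 1" "\<And>n. n \<in> I \<Longrightarrow> d n \<noteq> 0" and inj: "inj_on d I"
  shows "V_op (l2 I) (l2 I) (diag I d) = diag I (\<lambda>n. sqrt (d n))"
  unfolding V_op_def sqrt_abs_diag[OF d(1,2) inj]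
proof (rule the_equality)
  let ?S = "diag I (\<lambda>n. sqrt (d n))"
  have S: "?S \<in> bop (l2 I) (l2 I)" by (rule diag_bop) (simp add: d)
  show "reduced_solution (l2 I) (l2 I) (l2 I) ?S (diag I d) ?S"
    by (rule reduced_solution_diagI)
      (use d S in \<open>auto simp: diag_apply intro!: diag_bop simp flip: mult.assoc of_real_mult\<close>)
  fix V assume "reduced_solution (l2 I) (l2 I) (l2 I) ?S (diag I d) V"
  then have V: "V \<in> bop (l2 I) (l2 I)" and eq: "compose (l2set I) ?S V = diag I d"
    by (auto simp: reduced_solution_def)
  show "V = ?S"
  proof (rule bop_l2_eqI[OF V S])
    fix x assume x: "x \<in> l2set I"
    have "V x n = of_real (sqrt (d n)) * x n" for n
    proof (cases "n \<in> I")
      case True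
      have "of_real (sqrt (d n)) * V x n = of_real (d n) * x n"
        using fun_cong[OF fun_cong[OF eq, of x], of n] x bop_l2_mem[OF V x]
        by (simp add: compose_def diag_apply)
      also have "\<dots> = of_real (sqrt (d n)) * (of_real (sqrt (d n)) * x n)"
        using d(1)[of n] by (simp flip: mult.assoc of_real_mult)
      finally show ?thesis using d(3)[OF True] by simp
    qed (simp add: l2set_eq_0[OF x] l2set_eq_0[OF bop_l2_mem[OF V x]])
    then show "V x = ?S x" using x by (auto simp: diag_apply)
  qed
qed

section \<open>Coordinate subspaces, projections and rank-one operators\<close>

text \<open>If \<open>x\<close> has a nonzero entry at some \<open>n\<close> outside
  \<open>I\<close>, then every member of the subspace has distance at least
  \<open>cmod (x n)\<close> from \<open>x\<close>, so the ball of that radius avoids the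
  subspace.\<close>

lemma closed_subspace_l2: "closed_subspace (l2set I) (l2 UNIV)"
  unfolding closed_subspace_def
proof
  show "submodule (l2set I) (ring_of_type_algebra :: complex ring) (l2 UNIV)"
    by (rule Module.module.submoduleI[OF module_l2])
      (auto simp: l2_uminus[OF l2set_mono] l2set_minus l2set_add l2set_smult intro: l2set_mono)
  interpret Metric_space "l2set UNIV" "hdist (l2 UNIV)" by (rule Metric_space_l2)
  have "\<exists>r>0. disjnt (l2set I) (mball x r)" if "x \<in> l2set UNIV - l2set I" for x
  proof -
    from that obtain n where n: "n \<notin> I" "x n \<noteq> 0" by (auto simp: l2set_def)
    have "cmod (x n) \<le> hdist (l2 UNIV) x y" if "y \<in> l2set I" for y
      using that norm_le_l2norm[OF l2set_diff[of x UNIV y], of n] n \<open>x \<in> _\<close>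
      by (simp add: hdist_l2 l2set_mono[OF that] l2set_eq_0[OF that])
    then have "disjnt (l2set I) (mball x (cmod (x n)))"
      by (force simp: disjnt_iff in_mball)
    then show ?thesis using n by (intro exI[where x = "cmod (x n)"]) simp
  qed
  then show "closedin (htopology (l2 UNIV)) (l2set I)"
    by (auto simp: htopology_def closedin_metric intro: l2set_mono)
qed

lemma orth_compl_l2: "orth_compl (l2 UNIV) (l2set I) = l2set (- I)"
proof
  show "orth_compl (l2 UNIV) (l2set I) \<subseteq> l2set (- I)"
  proof
    fix x assume "x \<in> orth_compl (l2 UNIV) (l2set I)"
    then have x: "x \<in> l2set UNIV" and o: "\<And>y. y \<in> l2set I \<Longrightarrow> (\<Sum>n. x n * cnj (y n)) = 0"
      by (auto simp: orth_compl_def)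
    have "x n = 0" if "n \<in> I" for n
      using o[OF l2unit_in[OF that]] by simp
    with x show "x \<in> l2set (- I)" by (simp add: l2set_def)
  qed
  show "l2set (- I) \<subseteq> orth_compl (l2 UNIV) (l2set I)"
  proof
    fix x assume x: "x \<in> l2set (- I)"
    have "(\<Sum>n. x n * cnj (y n)) = 0" if "y \<in> l2set I" for y
    proof -
      have "x n * cnj (y n) = 0" for n
        using l2set_eq_0[OF x, of n] l2set_eq_0[OF that, of n] by auto
      then show ?thesis by (simp only: suminf_zero)
    qed
    then show "x \<in> orth_compl (l2 UNIV) (l2set I)"
      using l2set_mono[OF x] by (simp add: orth_compl_def)
  qed
qed

lemma l2set_cut: "x \<in> l2set J \<Longrightarrow> (\<lambda>n. if n \<in> I then x n else 0) \<in> l2set I"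
  by (rule l2set_dominated[where b = 1]) auto

lemma proj_l2:
  assumes "x \<in> l2set UNIV"
  shows "proj (l2 UNIV) (l2set I) x = (\<lambda>n. if n \<in> I then x n else 0)"
proof -
  have "(THE y. y \<in> l2set I \<and> x \<ominus>\<^bsub>l2 UNIV\<^esub> y \<in> l2set (- I)) = (\<lambda>n. if n \<in> I then x n else 0)"
  proof (rule the_equality)
    have "(\<lambda>n. x n - (if n \<in> I then x n else 0)) = (\<lambda>n. if n \<in> - I then x n else 0)" by auto
    with assms show "(\<lambda>n. if n \<in> I then x n else 0) \<in> l2set I \<and>
        x \<ominus>\<^bsub>l2 UNIV\<^esub> (\<lambda>n. if n \<in> I then x n else 0) \<in> l2set (- I)"
      using l2set_cut[OF assms, of I] l2set_cut[OF assms, of "- I"]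
      by (simp add: l2_minus l2set_mono[OF l2set_cut[OF assms]])
  next
    fix y assume y: "y \<in> l2set I \<and> x \<ominus>\<^bsub>l2 UNIV\<^esub> y \<in> l2set (- I)"
    then have "(\<lambda>n. x n - y n) \<in> l2set (- I)"
      using l2_minus[OF l2set_mono[OF _ subset_UNIV], of y I x] by simp
    then show "y = (\<lambda>n. if n \<in> I then x n else 0)"
      using y by (auto simp: l2set_def fun_eq_iff)
  qed
  with assms show ?thesis by (simp add: proj_def orth_compl_l2)
qed

lemma coproj_l2:
  assumes "x \<in> l2set UNIV"
  shows "coproj (l2 UNIV) (l2set I) x = (\<lambda>n. if n \<in> I then 0 else x n)"
  using assms by (auto simp: coproj_def proj_l2 l2_minus l2set_mono[OF l2set_cut[OF assms]])

text \<open>A coordinate is a functional of norm at most one. Operators of this form supply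
  \<open>T21\<close>, the adjoint of \<open>T12\<close> and the solutions of all four
  systems.\<close>

lemma rank_one_bop:
  assumes w: "w \<in> l2set J"
  shows "(\<lambda>x\<in>l2set I. \<lambda>n. x k * w n) \<in> bop (l2 I) (l2 J)"
proof -
  have "l2norm (\<lambda>n. x k * w n) \<le> l2norm w * l2norm x" if x: "x \<in> l2set I" for x
  proof -
    have "l2norm (\<lambda>n. x k * w n) \<le> cmod (x k) * l2norm w"
      by (rule l2norm_dominated[OF w]) (auto simp: norm_mult)
    also have "\<dots> \<le> l2norm x * l2norm w"
      by (intro mult_right_mono norm_le_l2norm[OF x] l2norm_nonneg[OF w])
    finally show ?thesis by (simp add: mult.commute)
  qed
  then show ?thesis
    by (intro bop_l2I[where b = "l2norm w"]) (auto simp: l2set_add l2set_smult w algebra_simps)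
qed

section \<open>The counterexample\<close>

text \<open>The entry at index \<open>0\<close> is set to zero to place the sequence in the
  orthogonal complement of \<open>l2set {0}\<close>.\<close>

definition geo :: "real \<Rightarrow> nat \<Rightarrow> complex"
  where "geo q = (\<lambda>n. if n = 0 then 0 else of_real (q ^ n))"

lemma geo_l2:
  assumes "0 \<le> q" "q < 1"
  shows "geo q \<in> l2set (- {0})"
proof -
  have "summable (\<lambda>n. (q ^ 2) ^ n)"
    using assms by (intro summable_geometric) (simp add: power_less_one_iff abs_square_less_1)
  then have "summable (\<lambda>n. (cmod (geo q n))\<^sup>2)"
    by (rule summable_comparison_test'[where N = 0])
      (use assms in \<open>auto simp: geo_def norm_power mult.commute simp flip: power_mult\<close>)
  then show ?thesis by (auto simp: l2set_def geo_def)
qed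

text \<open>\<open>geo (1/4)\<close> has two roles: it is the diagonal of \<open>T22\<close> and the
  image of the first unit vector under \<open>T21\<close>. Their quotient is therefore constantly
  \<open>1\<close> at positive indices.\<close>

definition counterexample_op :: "(nat \<Rightarrow> complex) \<Rightarrow> nat \<Rightarrow> complex"
  where "counterexample_op = (\<lambda>x\<in>l2set UNIV. \<lambda>n. geo (1/4) n * x n + x 0 * geo (1/4) n)"

text \<open>The operator is the sum of a diagonal and a rank-one operator, and the two bounds add
  up.\<close>

lemma counterexample_op_bop: "counterexample_op \<in> bop (l2 UNIV) (l2 UNIV)"
proof -
  let ?D = "diag UNIV (\<lambda>n. if n = 0 then 0 else (1/4) ^ n)"
  let ?R = "\<lambda>x\<in>l2set UNIV. \<lambda>n. x 0 * geo (1/4) n"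
  have D: "?D \<in> bop (l2 UNIV) (l2 UNIV)"
    by (rule diag_bop) (auto simp: power_le_one)
  have R: "?R \<in> bop (l2 UNIV) (l2 UNIV)"
    by (intro rank_one_bop l2set_mono[OF geo_l2]) auto
  have eq: "counterexample_op x = (\<lambda>n. ?D x n + ?R x n)" if "x \<in> l2set UNIV" for x
    using that by (auto simp: counterexample_op_def diag_def geo_def)
  obtain a b where "\<And>x. x \<in> l2set UNIV \<Longrightarrow> l2norm (?D x) \<le> a * l2norm x"
    and "\<And>x. x \<in> l2set UNIV \<Longrightarrow> l2norm (?R x) \<le> b * l2norm x"
    using D R unfolding bop_l2_iff by meson
  then have bound: "l2norm (counterexample_op x) \<le> (a + b) * l2norm x" if "x \<in> l2set UNIV" for x
    unfolding eq[OF that] using that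
    by (intro order_trans[OF l2norm_triangle[OF bop_l2_mem[OF D that] bop_l2_mem[OF R that]]])
      (simp add: distrib_right add_mono)
  have "counterexample_op x \<in> l2set UNIV" if "x \<in> l2set UNIV" for x
    unfolding eq[OF that] by (rule l2set_add[OF bop_l2_mem[OF D that] bop_l2_mem[OF R that]])
  moreover have "counterexample_op \<in> extensional (l2set UNIV)"
    by (simp add: counterexample_op_def)
  ultimately show ?thesis
    using bound
    by (intro bop_l2I[where b = "a + b"])
      (auto simp: counterexample_op_def l2set_add l2set_smult algebra_simps)
qed

lemma counterexample_weakly_complementable:
  "weakly_complementable (l2 UNIV) (l2set {0}) counterexample_op"
proof -
  let ?J = "- {0} :: nat set"
  \<comment> \<open>Unlike \<open>geo (1/4)\<close>, this sequence is \<open>1\<close> at index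
    \<open>0\<close>; the two agree on \<open>?J\<close>, the support of the sequences on which
    \<open>T22\<close> acts.\<close>
  let ?d = "\<lambda>n::nat. (1/4::real) ^ n"
  have T_mem: "counterexample_op x \<in> l2set UNIV" if "x \<in> l2set UNIV" for x
    by (rule bop_l2_mem[OF counterexample_op_bop that])
  have J: "x \<in> l2set UNIV" "x 0 = 0" if "x \<in> l2set ?J" for x
    using that l2set_mono[OF that] l2set_eq_0[OF that] by auto
  have cJ: "coproj (l2 UNIV) (l2set {0}) x = x" if "x \<in> l2set ?J" for x
    using J[OF that] by (auto simp: coproj_l2)
  have TJ: "counterexample_op x = (\<lambda>n. geo (1/4) n * x n)" if "x \<in> l2set ?J" for x
    using J[OF that] by (simp add: counterexample_op_def)
  have TJ_mem: "(\<lambda>n. geo (1/4) n * x n) \<in> l2set UNIV" if "x \<in> l2set ?J" for x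
    using T_mem[OF J(1)[OF that]] TJ[OF that] by simp
  \<comment> \<open>On \<open>?J\<close> the operator is diagonal and its output vanishes at
    \<open>0\<close>, so this block is zero. It is written with \<open>x 0 * 0\<close> to match
    \<open>?Z\<close> below, which is an instance of \<open>rank_one_bop\<close> with zero
    \<open>w\<close>.\<close>
  have T12: "T12 (l2 UNIV) (l2set {0}) counterexample_op = (\<lambda>x\<in>l2set ?J. \<lambda>n. x 0 * 0)"
  proof (rule ext)
    fix x
    show "T12 (l2 UNIV) (l2set {0}) counterexample_op x = (\<lambda>x\<in>l2set ?J. \<lambda>n. x 0 * 0) x"
      by (cases "x \<in> l2set ?J")
        (auto simp: T12_def orth_compl_l2 cJ TJ proj_l2 TJ_mem, auto simp: geo_def)
  qed
  have T21: "T21 (l2 UNIV) (l2set {0}) counterexample_op = (\<lambda>x\<in>l2set {0}. \<lambda>n. x 0 * geo (1/4) n)"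
  proof
    fix x
    show "T21 (l2 UNIV) (l2set {0}) counterexample_op x
      = (\<lambda>x\<in>l2set {0}. \<lambda>n. x 0 * geo (1/4) n) x"
    proof (cases "x \<in> l2set {0}")
      case True
      then have x: "x \<in> l2set UNIV" by (rule l2set_mono) simp
      have "proj (l2 UNIV) (l2set {0}) x = x"
        using l2set_eq_0[OF True] by (auto simp: proj_l2 x)
      then show ?thesis using True l2set_eq_0[OF True]
        by (auto simp: T21_def coproj_l2 T_mem x) (auto simp: counterexample_op_def x geo_def)
    qed (simp add: T21_def)
  qed
  have T22: "T22 (l2 UNIV) (l2set {0}) counterexample_op = diag ?J ?d"
  proof (rule ext)
    fix x
    show "T22 (l2 UNIV) (l2set {0}) counterexample_op x = diag ?J ?d x"
      by (cases "x \<in> l2set ?J")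
        (auto simp: T22_def orth_compl_l2 cJ TJ coproj_l2 TJ_mem diag_def, auto simp: geo_def J)
  qed
  have d: "\<And>n. 0 \<le> ?d n" "\<And>n. ?d n \<le> 1" and inj: "inj_on ?d ?J"
    by (auto simp: power_le_one inj_on_def power_inject_exp')
  have sqrt: "sqrt (?d n) = (1/2) ^ n" for n
    by (simp add: real_sqrt_power real_sqrt_divide)
  have V: "V_op (l2 ?J) (l2 ?J) (diag ?J ?d) = diag ?J (\<lambda>n. sqrt (?d n))"
    by (rule V_op_diag[OF d _ inj]) simp
  let ?S = "diag ?J (\<lambda>n. (1/2) ^ n)"
  have adjS: "adj (l2 ?J) (l2 ?J) ?S = ?S"
    by (rule adj_diag) (simp add: power_le_one)
  let ?Z = "\<lambda>x\<in>l2set {0}. \<lambda>n. x 0 * 0"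
  have Z: "?Z \<in> bop (l2 {0}) (l2 ?J)"
    by (rule rank_one_bop) simp
  have adj12: "adj (l2 ?J) (l2 {0}) (\<lambda>x\<in>l2set ?J. \<lambda>n. x 0 * 0) = ?Z"
    by (rule adj_l2_eqI[OF Z]) simp
  \<comment> \<open>Dividing \<open>(1/4) ^ n\<close> by the entry \<open>(1/2) ^ n\<close> of
    \<open>?S\<close> leaves \<open>(1/2) ^ n\<close>, which is still square summable.\<close>
  let ?Y = "\<lambda>x\<in>l2set {0}. \<lambda>n. x 0 * geo (1/2) n"
  have "reduced_solution (l2 {0}) (l2 ?J) (l2 ?J) ?S (\<lambda>x\<in>l2set {0}. \<lambda>n. x 0 * geo (1/4) n) ?Y"
  proof (rule reduced_solution_diagI)
    show "?Y \<in> bop (l2 {0}) (l2 ?J)"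
      "(\<lambda>x\<in>l2set {0}. \<lambda>n. x 0 * geo (1/4) n) \<in> bop (l2 {0}) (l2 ?J)"
      by (intro rank_one_bop geo_l2; simp)+
  qed (auto simp: power_le_one geo_def simp flip: of_real_mult power_mult_distrib)
  moreover have "reduced_solution (l2 {0}) (l2 ?J) (l2 ?J) ?S ?Z ?Z"
    by (rule reduced_solution_diagI) (use Z in \<open>auto simp: power_le_one\<close>)
  \<comment> \<open>All four coefficient operators equal \<open>?S\<close>, and the right-hand sides
    are \<open>T21\<close> twice and the zero operator \<open>?Z\<close> twice. Hence
    \<open>?Y\<close> and \<open>?Z\<close> solve all four systems.\<close>
  ultimately show ?thesis
    unfolding weakly_complementable_def has_reduced_solution_def Let_def orth_compl_l2 l2_simps
      T12 T21 T22 V sqrt_abs_diag[OF d inj] sqrt adjS adj12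
    by blast
qed

text \<open>If \<open>Q T M\<^sub>r = Q T\<close>, then \<open>M\<^sub>r\<close> maps \<open>e\<^sub>0\<close> to a sequence with all entries after the first equal
  to \<open>1\<close>.\<close>

lemma counterexample_not_complementable:
  "\<not> complementable (l2 UNIV) (l2set {0}) counterexample_op"
proof
  let ?Q = "coproj (l2 UNIV) (l2set {0})"
  let ?T = counterexample_op
  let ?e = "l2unit 0"
  assume "complementable (l2 UNIV) (l2set {0}) ?T"
  then obtain R where R: "R \<in> bop (l2 UNIV) (l2 UNIV)"
    and QR: "compose (l2set UNIV) ?Q R = R"
    and QTR: "compose (l2set UNIV) ?Q (compose (l2set UNIV) ?T R) = compose (l2set UNIV) ?Q ?T"
    unfolding complementable_def Let_def by auto
  have e: "?e \<in> l2set UNIV" by simp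
  define y where "y = R ?e"
  have y: "y \<in> l2set UNIV" unfolding y_def by (rule bop_l2_mem[OF R e])
  \<comment> \<open>The condition \<open>Q R = R\<close> removes the entry of \<open>y\<close> at
    \<open>0\<close>, and with it the rank-one term of \<open>?T y\<close>; only the diagonal part
    remains.\<close>
  have "?Q y = y"
    using fun_cong[OF QR, of ?e] e by (simp add: compose_eq y_def)
  then have y0: "y 0 = 0" using y by (auto simp: coproj_l2 fun_eq_iff split: if_splits)
  have T_mem: "?T x \<in> l2set UNIV" if "x \<in> l2set UNIV" for x
    by (rule bop_l2_mem[OF counterexample_op_bop that])
  have "?Q (?T y) = ?Q (?T ?e)"
    using fun_cong[OF QTR, of ?e] e by (simp add: compose_eq y_def)
  then have T: "?T y n = ?T ?e n" if "n \<noteq> 0" for n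
    using that by (auto simp: coproj_l2 T_mem y fun_eq_iff split: if_splits)
  have "y n = 1" if "n \<noteq> 0" for n
  proof -
    have "geo (1/4) n * y n = geo (1/4) n"
      using T[OF that] that y0 by (simp add: counterexample_op_def y e) (simp add: l2unit_def)
    with that show ?thesis by (simp add: geo_def)
  qed
  moreover have "(\<lambda>n. (cmod (y n))\<^sup>2) \<longlonglongrightarrow> 0"
    by (rule summable_LIMSEQ_zero[OF l2set_summable[OF y]])
  \<comment> \<open>The shift drops the entry at \<open>0\<close>, which is \<open>0\<close>; all
    remaining entries are \<open>1\<close>, contradicting the limit \<open>0\<close>.\<close>
  then have "(\<lambda>n. (cmod (y (Suc n)))\<^sup>2) \<longlonglongrightarrow> 0" by (rule LIMSEQ_Suc)
  ultimately show False by (simp add: LIMSEQ_const_iff)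
qed

theorem theorem6p4:
  shows "\<exists>(K :: (nat \<Rightarrow> complex) hspace) M T.
    hilbert_space K \<and> closed_subspace M K \<and> T \<in> bop K K \<and>
    weakly_complementable K M T \<and> \<not> complementable K M T"
  using hilbert_space_l2 closed_subspace_l2 counterexample_op_bop
    counterexample_weakly_complementable counterexample_not_complementable by blast

end
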